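(* Assume that $\alpha_n \to \infty$ and $\alpha_n = o(\log n)$. Then $$M_n - \log n - (\alpha_n - 1) \log \log n - \xi_n + \log \Gamma(\alpha_n)$$ converges in distribution to $G$ as $n\to\infty$, where $\xi_n / \log n$ is (for all sufficiently large $n$) the unique positive solution of the equation (in the unknown $z$) $$z = \frac{\alpha_n - 1}{\log n} \log \left[ 1 - \frac{\alpha_n}{\log n} \log \frac{\alpha_n}{\log n} + \frac{\alpha_n - \log \log n}{\log n} + \frac{1}{2} \frac{\log \alpha_n}{\log n} + z \right].$$
   Context: Let $(\alpha_n)_{n\ge 1}$ be a sequence of positive real numbers. For each $n$, let $Y_{1n},\ldots,Y_{nn}$ be i.i.d. random variables with the Gamma$(\alpha_n,1)$ distribution, i.e. with density $u^{\alpha_n-1}e^{-u}/\Gamma(\alpha_n)$ on $(0,\infty)$, and let $M_n=\max\{Y_{1n},\ldots,Y_{nn}\}$. $G$ denotes the Gumbel distribution, with distribution function $G(x)=\exp(-e^{-x})$, $x\in\mathbb R$. *)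

theory Defs
  imports "HOL-Probability.Probability" "HOL-Library.Landau_Symbols" "HOL-Real_Asymp.Real_Asymp"
begin

text \<open>Density of the Gamma distribution with shape \<open>a\<close> and rate 1.\<close>
definition gamma_density :: "real \<Rightarrow> real \<Rightarrow> real" where
  "gamma_density a u = (if u > 0 then u powr (a - 1) * exp (- u) / Gamma a else 0)"

definition gumbel_cdf :: "real \<Rightarrow> real" where
  "gumbel_cdf x = exp (- exp (- x))"

definition gumbel_distribution :: "real measure" where
  "gumbel_distribution = interval_measure gumbel_cdf"

lemma cdf_gumbel_distribution: "cdf gumbel_distribution = gumbel_cdf"
  unfolding gumbel_distribution_def
proof (rule cdf_interval_measure)
  show "gumbel_cdf x \<le> gumbel_cdf y" if "x \<le> y" for x y
    using that by (simp add: gumbel_cdf_def)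
  show "continuous (at_right a) gumbel_cdf" for a
    unfolding gumbel_cdf_def by (intro continuous_intros)
  show "(gumbel_cdf \<longlongrightarrow> 0) at_bot"
    unfolding gumbel_cdf_def by real_asymp
qed

lemma real_distribution_gumbel: "real_distribution gumbel_distribution"
  unfolding gumbel_distribution_def
proof (rule real_distribution_interval_measure)
  show "gumbel_cdf x \<le> gumbel_cdf y" if "x \<le> y" for x y
    using that by (simp add: gumbel_cdf_def)
  show "continuous (at_right a) gumbel_cdf" for a
    unfolding gumbel_cdf_def by (intro continuous_intros)
  show "(gumbel_cdf \<longlongrightarrow> 0) at_bot" "(gumbel_cdf \<longlongrightarrow> 1) at_top"
    unfolding gumbel_cdf_def by real_asymp+
qed

text \<open>
  The centring equation, with \<open>a\<close> for the shape parameter and \<open>L\<close> for \<open>log n\<close>. Since the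
  logarithm is a total function here, a solution is explicitly required to make its argument
  positive.
\<close>
definition centring_arg :: "real \<Rightarrow> real \<Rightarrow> real \<Rightarrow> real" where
  "centring_arg a L z =
     1 - a / L * ln (a / L) + (a - ln L) / L + 1 / 2 * (ln a / L) + z"

definition is_centring_root :: "real \<Rightarrow> real \<Rightarrow> real \<Rightarrow> bool" where
  "is_centring_root a L z \<longleftrightarrow>
     z > 0 \<and> centring_arg a L z > 0 \<and> z = (a - 1) / L * ln (centring_arg a L z)"

end

theory Submission
  imports Defs
begin

text \<open>
  With \<open>L = ln n\<close>, let \<open>u = L + (\<alpha> - 1) ln L + \<xi> - ln (Gamma \<alpha>) + x\<close> be the threshold. Its exceedance
  probability is asymptotic to the density at \<open>u\<close>, because \<open>\<alpha> / u\<close> tends to 0. Since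
  \<open>ln (Gamma \<alpha>) = \<alpha> ln \<alpha> - \<alpha> - (ln \<alpha>) / 2 + O(1)\<close>, the argument \<open>A\<close> of the logarithm in the centring
  equation is \<open>u / L\<close> up to \<open>O(1 / L)\<close>, and \<open>A > 1\<close>. Multiplying the density by \<open>n\<close> and inserting
  \<open>\<xi> = (\<alpha> - 1) ln A\<close> leaves \<open>exp ((\<alpha> - 1) ln (u / (L A)) - x)\<close>, whose exponent is \<open>O(\<alpha> / L) - x\<close>.
\<close>

section \<open>Poisson limit for the probability of no exceedance\<close>

text \<open>Convergence of \<open>n * p n\<close> forces \<open>p n\<close> to 0, so
  \<open>n * ln (1 - p n)\<close> differs from \<open>- n * p n\<close> by at most
  \<open>2 * n * (p n)^2\<close>, which vanishes.\<close>

lemma tendsto_one_minus_power: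
  fixes p :: "nat \<Rightarrow> real"
  assumes lim: "(\<lambda>n. real n * p n) \<longlonglongrightarrow> c"
  shows "(\<lambda>n. (1 - p n) ^ n) \<longlonglongrightarrow> exp (- c)"
proof -
  have "(\<lambda>n. (real n * p n) * (1 / real n)) \<longlonglongrightarrow> c * 0"
    by (intro tendsto_mult lim lim_1_over_n)
  moreover have "\<forall>\<^sub>F n in sequentially. (real n * p n) * (1 / real n) = p n"
    using eventually_gt_at_top[of 0] by eventually_elim simp
  ultimately have p0: "p \<longlonglongrightarrow> 0"
    by (simp add: tendsto_cong)
  have small: "\<forall>\<^sub>F n in sequentially. \<bar>p n\<bar> < 1 / 2"
    using tendstoD[OF p0, of "1/2"] by (simp add: dist_real_def)
  have err: "(\<lambda>n. real n * ln (1 - p n) + real n * p n) \<longlonglongrightarrow> 0"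
  proof (rule Lim_null_comparison)
    have "(\<lambda>n. 2 * (real n * p n) * p n) \<longlonglongrightarrow> 2 * c * 0"
      by (intro tendsto_intros lim p0)
    then show "(\<lambda>n. 2 * (real n * p n) * p n) \<longlonglongrightarrow> 0" by simp
    show "\<forall>\<^sub>F n in sequentially. norm (real n * ln (1 - p n) + real n * p n)
        \<le> 2 * (real n * p n) * p n"
      using small
    proof eventually_elim
      case (elim n)
      have "\<bar>ln (1 + - p n) - - p n\<bar> \<le> 2 * (- p n)\<^sup>2"
        by (rule abs_ln_one_plus_x_minus_x_bound) (use elim in simp)
      then have "real n * \<bar>ln (1 - p n) + p n\<bar> \<le> real n * (2 * (p n)\<^sup>2)"
        by (intro mult_left_mono) auto
      then show ?case
        by (simp add: abs_mult power2_eq_square flip: distrib_left)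
    qed
  qed
  have "(\<lambda>n. exp ((real n * ln (1 - p n) + real n * p n) - real n * p n)) \<longlonglongrightarrow> exp (0 - c)"
    by (intro tendsto_intros err lim)
  moreover have "\<forall>\<^sub>F n in sequentially.
      exp ((real n * ln (1 - p n) + real n * p n) - real n * p n) = (1 - p n) ^ n"
    \<comment> \<open>Smallness of \<open>p n\<close> makes \<open>1 - p n\<close> positive, so the
      power is \<open>exp (n * ln (1 - p n))\<close>.\<close>
    using small by eventually_elim (simp add: exp_of_nat_mult)
  ultimately show ?thesis
    by (simp add: tendsto_cong)
qed

section \<open>Stirling's formula up to a bounded error\<close>

text \<open>The constant \<open>ln (2 * pi) / 2\<close> of Stirling's formula stays inside the
  remainder, as boundedness suffices. The subtracted terms are those that the centring equation
  contains.\<close>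

definition stirling_remainder :: "real \<Rightarrow> real" where
  "stirling_remainder a = ln (Gamma a) - (a * ln a - a - ln a / 2)"

text \<open>The increment is 1 minus \<open>a + 1 / 2\<close> times the integral of
  \<open>1 / t\<close> over \<open>[a, a + 1]\<close>. By convexity the midpoint rule bounds this
  integral from below and the trapezoidal rule from above; the trapezoidal excess
  \<open>1 / (4 * a) - 1 / (4 * (a + 1))\<close> telescopes.\<close>

lemma stirling_remainder_step:
  assumes "a > 0"
  shows "stirling_remainder (a + 1) \<le> stirling_remainder a"
    and "stirling_remainder a - 1 / (4 * a) \<le> stirling_remainder (a + 1) - 1 / (4 * (a + 1))"
proof -
  have "Gamma (a + 1) = a * Gamma a"
    using assms by (intro Gamma_plus1) (auto elim!: nonpos_Ints_cases)
  then have "ln (Gamma (a + 1)) = ln a + ln (Gamma a)"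
    using assms Gamma_real_pos[OF assms, THEN less_imp_neq] by (simp add: ln_mult)
  then have eq: "stirling_remainder (a + 1) - stirling_remainder a
      = 1 - (a + 1 / 2) * (ln (a + 1) - ln a)"
    by (simp add: stirling_remainder_def algebra_simps add_divide_distrib)
  have "(a + 1 / 2) * (ln (a + 1) - ln a) \<ge> (a + 1 / 2) * (2 / (2 * a + 1))"
    using ln_inverse_approx_ge[of a "a + 1"] assms
    by (intro mult_left_mono) (auto simp: algebra_simps)
  also have "(a + 1 / 2) * (2 / (2 * a + 1)) = 1"
    using assms by (simp add: field_simps)
  finally show "stirling_remainder (a + 1) \<le> stirling_remainder a"
    using eq by linarith
  have "(a + 1 / 2) * (ln (a + 1) - ln a) \<le> (a + 1 / 2) * ((inverse a + inverse (a + 1)) / 2)"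
    using ln_inverse_approx_le[of a 1] assms by (intro mult_left_mono) auto
  also have "\<dots> = 1 + 1 / (4 * a) - 1 / (4 * (a + 1))"
  proof -
    have "a \<noteq> 0" "a + 1 \<noteq> 0" using assms by auto
    then show ?thesis by (simp add: divide_simps) (simp add: algebra_simps)
  qed
  finally show "stirling_remainder a - 1 / (4 * a) \<le> stirling_remainder (a + 1) - 1 / (4 * (a + 1))"
    using eq by linarith
qed

text \<open>Compactness gives a bound on \<open>[1, 2]\<close>. Unit steps carry it to all larger
  arguments: the remainder never rises along them, and its total drop from \<open>b\<close> is at
  most \<open>1 / (4 * b)\<close>.\<close>

lemma stirling_remainder_bounded:
  obtains C where "\<And>a. a \<ge> 1 \<Longrightarrow> \<bar>stirling_remainder a\<bar> \<le> C"
proof -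
  have "continuous_on {1..2} stirling_remainder"
    unfolding stirling_remainder_def
  proof (intro continuous_intros)
    show "{1..2} \<inter> \<int>\<^sub>\<le>\<^sub>0 = ({} :: real set)"
      by (auto elim!: nonpos_Ints_cases)
    show "\<forall>x\<in>{1..2::real}. Gamma x \<noteq> 0"
      by (auto simp: Gamma_eq_zero_iff elim!: nonpos_Ints_cases)
  qed auto
  then have "bounded (stirling_remainder ` {1..2})"
    by (intro compact_imp_bounded compact_continuous_image) auto
  then obtain B where B: "\<bar>stirling_remainder a\<bar> \<le> B" if "a \<in> {1..2}" for a
    unfolding bounded_iff by (metis imageI real_norm_def)
  have shift: "stirling_remainder (a + real k) \<le> stirling_remainder a \<and>
      stirling_remainder a - 1 / (4 * a) \<le> stirling_remainder (a + real k) - 1 / (4 * (a + real k))"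
    if "a > 0" for a k
  proof (induction k)
    case (Suc k)
    then show ?case
      using stirling_remainder_step[of "a + real k"] that by (simp add: algebra_simps)
  qed simp
  have "\<bar>stirling_remainder a\<bar> \<le> B + 1" if "a \<ge> 1" for a
  proof -
    \<comment> \<open>This \<open>k\<close> puts \<open>b = a - k\<close> between 1 and 2.\<close>
    define k where "k = nat (\<lfloor>a\<rfloor> - 1)"
    define b where "b = a - real k"
    have "real k = of_int \<lfloor>a\<rfloor> - 1"
      using that by (simp add: k_def)
    then have b: "b \<in> {1..2}"
      unfolding b_def atLeastAtMost_iff using floor_correct[of a] by linarith
    then have inv: "1 / (4 * b) \<le> 1" "0 \<le> 1 / (4 * a)"
      using that by auto
    have ba: "b + real k = a" and "b > 0"
      using b by (auto simp: b_def)
    have "stirling_remainder a \<le> stirling_remainder b"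
      "stirling_remainder b - 1 / (4 * b) \<le> stirling_remainder a - 1 / (4 * a)"
      using shift[OF \<open>b > 0\<close>, of k] unfolding ba by auto
    with inv B[OF b] show ?thesis
      by (smt (verit))
  qed
  then show ?thesis by (rule that)
qed

section \<open>The centring equation and its positive root\<close>

text \<open>After multiplication by \<open>L\<close> the excess over 1 splits into
  \<open>(a - 1) * ln (L / a)\<close> and \<open>a - ln a / 2\<close>, the first nonnegative and the
  second positive.\<close>

lemma centring_arg_0_gt_1:
  assumes "1 < a" "a < L"
  shows "1 < centring_arg a L 0"
proof -
  have "L * (centring_arg a L 0 - 1) = (a - 1) * (ln L - ln a) + (a - ln a / 2)"
    using assms by (simp add: centring_arg_def ln_div field_simps)
  also have "\<dots> > 0"
  proof (intro add_nonneg_pos mult_nonneg_nonneg)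
    show "0 < a - ln a / 2"
      using assms ln_less_self[of a] by linarith
  qed (use assms in auto)
  finally show ?thesis
    using assms by (simp add: zero_less_mult_iff)
qed

lemma centring_arg_shift: "centring_arg a L z = centring_arg a L 0 + z"
  by (simp add: centring_arg_def)

text \<open>The bound \<open>2 * a < L\<close> keeps the coefficient \<open>r\<close> of the
  logarithm below 1/2, and the argument exceeds 1. Hence \<open>f\<close> is strictly increasing on
  the nonnegative reals, and it changes sign between 0 and \<open>c\<close>.\<close>

lemma ex1_centring_root:
  assumes a: "1 < a" "2 * a < L"
  shows "\<exists>!z. is_centring_root a L z"
proof -
  define c where "c = centring_arg a L 0"
  define r where "r = (a - 1) / L"
  define f where "f z = z - r * ln (c + z)" for z
  have c: "c > 1"
    using centring_arg_0_gt_1[of a L] a by (simp add: c_def)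
  have r: "0 < r" "r < 1 / 2"
    using a by (auto simp: r_def field_simps)
  have root_iff: "is_centring_root a L z \<longleftrightarrow> z > 0 \<and> f z = 0" for z
    using c by (auto simp: is_centring_root_def centring_arg_shift[of a L z] f_def r_def c_def)
  have mono: "f y < f z" if "0 \<le> y" "y < z" for y z
  proof (rule DERIV_pos_imp_increasing[OF that(2)])
    fix w assume w: "y \<le> w" "w \<le> z"
    have "r / (c + w) < 1"
      using r c w that by (simp add: divide_less_eq)
    moreover have "(f has_real_derivative 1 - r / (c + w)) (at w)"
      unfolding f_def using c w that by (auto intro!: derivative_eq_intros)
    ultimately show "\<exists>D. (f has_real_derivative D) (at w) \<and> D > 0"
      by (intro exI[of _ "1 - r / (c + w)"]) auto
  qed
  have f0: "f 0 < 0"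
    using r c by (simp add: f_def)
  \<comment> \<open>The right end \<open>c\<close> works because
    \<open>ln (2 * c) \<le> 2 * c\<close> and \<open>r < 1 / 2\<close>.\<close>
  have "r * ln (c + c) \<le> (1 / 2) * (2 * c)"
    using r c ln_le_minus_one[of "c + c"] by (intro mult_mono) auto
  then have fc: "f c \<ge> 0"
    by (simp add: f_def)
  have "continuous_on {0..c} f"
    unfolding f_def using c by (intro continuous_intros) auto
  then obtain z where z: "0 \<le> z" "z \<le> c" "f z = 0"
    using IVT'[of f 0 0 c] f0 fc c by auto
  show ?thesis
  proof (rule ex1I)
    show "is_centring_root a L z"
      using z f0 by (cases "z = 0") (auto simp: root_iff)
    fix y assume "is_centring_root a L y"
    then show "y = z"
      using mono[of y z] mono[of z y] z by (cases y z rule: linorder_cases) (auto simp: root_iff)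
  qed
qed

section \<open>Tail of the Gamma distribution against its density\<close>

text \<open>The comparison rests on \<open>-(s\<^sup>a\<^sup>-\<^sup>1 e\<^sup>-\<^sup>s)' = s\<^sup>a\<^sup>-\<^sup>1 e\<^sup>-\<^sup>s (1 - (a - 1) / s)\<close>.\<close>

lemma gamma_tail_bounds:
  fixes X :: "'a \<Rightarrow> real"
  assumes "prob_space N"
    and X: "distributed N lborel X (\<lambda>u. ennreal (gamma_density a u))"
    and a: "1 \<le> a" and u: "0 < u" "a - 1 \<le> u"
  defines "p \<equiv> measure N {\<omega> \<in> space N. u < X \<omega>}"
  shows "gamma_density a u \<le> p" and "(1 - (a - 1) / u) * p \<le> gamma_density a u"
proof -
  interpret prob_space N by fact
  have Gpos: "Gamma a > 0" using a by simp
  \<comment> \<open>For \<open>s \<ge> u\<close>, \<open>g s\<close> lies between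
    \<open>1 - (a - 1) / u\<close> times the density and the density itself. Its integral from
    \<open>u\<close> on is the density at \<open>u\<close>, so integrating both comparisons gives
    the two claims.\<close>
  define g where "g s = gamma_density a s * (1 - (a - 1) / s)" for s
  have [measurable]: "gamma_density a \<in> borel_measurable borel"
    unfolding gamma_density_def[abs_def] by measurable
  have g_nonneg: "0 \<le> g s" if "u \<le> s" for s
    using u that Gpos by (auto simp: g_def gamma_density_def divide_le_eq)
  have deriv: "((\<lambda>s. - (s powr (a - 1) * exp (- s) / Gamma a)) has_real_derivative g s) (at s)"
    if "u \<le> s" for s
  proof -
    have "s > 0" using u that by simp
    have pow: "((\<lambda>s. s powr (a - 1)) has_real_derivative (a - 1) * s powr (a - 1 - 1)) (at s)"
      by (rule has_real_derivative_powr[OF \<open>s > 0\<close>])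
    have "((\<lambda>s. - (s powr (a - 1) * exp (- s) / Gamma a)) has_real_derivative
        - (((a - 1) * s powr (a - 1 - 1) * exp (- s) - s powr (a - 1) * exp (- s)) / Gamma a)) (at s)"
      using \<open>s > 0\<close> Gpos[THEN less_imp_neq] by (auto intro!: derivative_eq_intros pow)
    moreover have "s powr (a - 1 - 1) = s powr (a - 1) / s"
      using \<open>s > 0\<close> by (subst powr_diff) simp
    then have "- (((a - 1) * s powr (a - 1 - 1) * exp (- s) - s powr (a - 1) * exp (- s)) / Gamma a)
        = g s"
      using Gpos \<open>s > 0\<close> by (simp only: g_def gamma_density_def) (simp add: field_simps)
    ultimately show ?thesis by simp
  qed
  have lim: "((\<lambda>s. - (s powr (a - 1) * exp (- s) / Gamma a)) \<longlongrightarrow> 0) at_top"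
  proof -
    have "((\<lambda>s. s powr (a - 1) * exp (- s)) \<longlongrightarrow> 0) at_top"
      by real_asymp
    then have "((\<lambda>s. - (s powr (a - 1) * exp (- s) / Gamma a)) \<longlongrightarrow> - (0 / Gamma a)) at_top"
      using Gpos by (intro tendsto_minus tendsto_divide tendsto_const) auto
    then show ?thesis by simp
  qed
  have g_int: "(\<integral>\<^sup>+s. ennreal (g s) * indicator {u..} s \<partial>lborel) = ennreal (gamma_density a u)"
    using nn_integral_FTC_atLeast[OF _ deriv g_nonneg lim] u
    by (simp add: g_def gamma_density_def)
  have "emeasure N {\<omega> \<in> space N. u < X \<omega>} = emeasure N (X -` {u<..} \<inter> space N)"
    by (rule arg_cong[where f = "emeasure N"]) auto
  also have "\<dots> = (\<integral>\<^sup>+s. ennreal (gamma_density a s) * indicator {u<..} s \<partial>lborel)"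
    by (rule distributed_emeasure[OF X]) simp
  \<comment> \<open>The endpoint is a null set; the closed half-line matches the domain in
    \<open>g_int\<close>.\<close>
  also have "\<dots> = (\<integral>\<^sup>+s. ennreal (gamma_density a s) * indicator {u..} s \<partial>lborel)"
    using AE_lborel_singleton[of u]
    by (intro nn_integral_cong_AE, eventually_elim) (auto split: split_indicator)
  finally have p: "ennreal p = (\<integral>\<^sup>+s. ennreal (gamma_density a s) * indicator {u..} s \<partial>lborel)"
    by (simp only: p_def emeasure_eq_measure)
  have dens_nonneg: "0 \<le> gamma_density a s" for s
    using Gpos by (simp add: gamma_density_def)
  have "ennreal (gamma_density a u) \<le> ennreal p"
    unfolding p g_int[symmetric]
  proof (intro nn_integral_mono)
    fix s
    show "ennreal (g s) * indicator {u..} s \<le> ennreal (gamma_density a s) * indicator {u..} s"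
      using a u dens_nonneg[of s]
      by (auto split: split_indicator intro!: ennreal_leI mult_left_le simp: g_def)
  qed
  then show "gamma_density a u \<le> p"
    by (simp add: p_def)
  have "ennreal ((1 - (a - 1) / u) * p) = (\<integral>\<^sup>+s. ennreal (1 - (a - 1) / u) *
      (ennreal (gamma_density a s) * indicator {u..} s) \<partial>lborel)"
    using u by (subst nn_integral_cmult) (auto simp: p[symmetric] ennreal_mult' p_def)
  also have "\<dots> \<le> (\<integral>\<^sup>+s. ennreal (g s) * indicator {u..} s \<partial>lborel)"
  proof (intro nn_integral_mono)
    fix s
    have "(1 - (a - 1) / u) * gamma_density a s \<le> g s" if "u \<le> s"
      unfolding g_def mult.commute[of "gamma_density a s"]
      using that a u dens_nonneg[of s] by (intro mult_right_mono diff_left_mono divide_left_mono) auto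
    then show "ennreal (1 - (a - 1) / u) * (ennreal (gamma_density a s) * indicator {u..} s)
        \<le> ennreal (g s) * indicator {u..} s"
      using u by (auto split: split_indicator simp flip: ennreal_mult' intro!: ennreal_leI)
  qed
  finally show "(1 - (a - 1) / u) * p \<le> gamma_density a u"
    using dens_nonneg[of u] by (simp add: g_int)
qed

section \<open>Distribution function of the maximum\<close>

text \<open>The maximum stays below \<open>u\<close> exactly when every variable does, so
  independence yields a product of equal factors.\<close>

lemma (in prob_space) prob_Max_le:
  fixes X :: "nat \<Rightarrow> 'a \<Rightarrow> real"
  assumes indep: "indep_vars (\<lambda>_. borel) X {1..n}" and n: "n \<ge> 1"
    and p: "\<And>i. i \<in> {1..n} \<Longrightarrow> prob {\<omega> \<in> space M. u < X i \<omega>} = p"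
  shows "prob {\<omega> \<in> space M. Max ((\<lambda>i. X i \<omega>) ` {1..n}) \<le> u} = (1 - p) ^ n"
proof -
  have meas: "X i \<in> borel_measurable M" if "i \<in> {1..n}" for i
    using indep that by (auto simp: indep_vars_def)
  have "{\<omega> \<in> space M. Max ((\<lambda>i. X i \<omega>) ` {1..n}) \<le> u} = (\<Inter>i\<in>{1..n}. X i -` {..u} \<inter> space M)"
    using n by auto
  then have "prob {\<omega> \<in> space M. Max ((\<lambda>i. X i \<omega>) ` {1..n}) \<le> u}
      = (\<Prod>i\<in>{1..n}. prob (X i -` {..u} \<inter> space M))"
    using indep_varsD_finite[OF indep, of "\<lambda>_. {..u}"] n by simp
  also have "\<dots> = (\<Prod>i\<in>{1..n}. 1 - p)"
  proof (intro prod.cong refl)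
    fix i assume i: "i \<in> {1..n}"
    note [measurable] = meas[OF i]
    have "X i -` {..u} \<inter> space M = space M - {\<omega> \<in> space M. u < X i \<omega>}"
      by auto
    then show "prob (X i -` {..u} \<inter> space M) = 1 - p"
      by (simp add: prob_compl p[OF i])
  qed
  finally show ?thesis by simp
qed

section \<open>The Gamma density at the threshold\<close>

lemma abs_ln_one_plus_le:
  fixes y :: real
  assumes "\<bar>y\<bar> \<le> 1 / 2"
  shows "\<bar>ln (1 + y)\<bar> \<le> 2 * \<bar>y\<bar>"
proof -
  have "2 * y\<^sup>2 \<le> \<bar>y\<bar>"
    using mult_right_mono[OF assms, of "\<bar>y\<bar>"] abs_mult_self_eq[of y]
    unfolding power2_eq_square by linarith
  then show ?thesis
    using abs_ln_one_plus_x_minus_x_bound[OF assms] by linarith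
qed

text \<open>Collects what the tail bounds and the Poisson limit require at the threshold. Everything
  rests on \<open>u n = L n * A n + e n\<close> with bounded \<open>e n\<close>.\<close>

lemma gamma_density_at_centring:
  fixes \<alpha> \<xi> :: "nat \<Rightarrow> real" and x :: real
  assumes top: "filterlim \<alpha> at_top sequentially"
    and o: "\<alpha> \<in> o[sequentially](\<lambda>n. ln (real n))"
    and root: "\<forall>\<^sub>F n in sequentially. is_centring_root (\<alpha> n) (ln (real n)) (\<xi> n / ln (real n))"
  defines "u \<equiv> \<lambda>n. x + ln (real n) + (\<alpha> n - 1) * ln (ln (real n)) + \<xi> n - ln (Gamma (\<alpha> n))"
  shows "\<forall>\<^sub>F n in sequentially. u n > 0"
    and "(\<lambda>n. (\<alpha> n - 1) / u n) \<longlonglongrightarrow> 0"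
    and "(\<lambda>n. real n * gamma_density (\<alpha> n) (u n)) \<longlonglongrightarrow> exp (- x)"
proof -
  define L where "L n = ln (real n)" for n
  define A where "A n = centring_arg (\<alpha> n) (L n) (\<xi> n / L n)" for n
  \<comment> \<open>This is exactly \<open>u n - L n * A n\<close>: the Stirling terms of
    \<open>ln (Gamma (\<alpha> n))\<close> cancel against those in the centring argument.\<close>
  define e where "e n = x - stirling_remainder (\<alpha> n)" for n
  obtain C where C: "\<bar>stirling_remainder a\<bar> \<le> C" if "a \<ge> 1" for a
    using stirling_remainder_bounded by blast
  define B where "B = \<bar>x\<bar> + C"
  have L_top: "filterlim L at_top sequentially"
    unfolding L_def by real_asymp
  have ratio: "(\<lambda>n. \<alpha> n / L n) \<longlonglongrightarrow> 0"
    using smalloD_tendsto[OF o] by (simp add: L_def)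
  \<comment> \<open>The condition \<open>L n > 2 * B\<close> makes \<open>e n\<close> less than half
    of \<open>L n\<close> in absolute value. This gives \<open>u n > L n / 2\<close> and keeps the
    relative error \<open>e n / (L n * A n)\<close> within 1/2.\<close>
  have ev: "\<forall>\<^sub>F n in sequentially. \<alpha> n > 1 \<and> \<alpha> n < L n \<and> L n > 2 * B \<and> A n > 1 \<and>
      \<bar>e n\<bar> \<le> B \<and> u n = L n * A n + e n \<and> \<xi> n = (\<alpha> n - 1) * ln (A n) \<and> n > 0"
    using filterlim_at_top_dense[THEN iffD1, OF top, rule_format, of 1]
      order_tendstoD(2)[OF ratio zero_less_one]
      filterlim_at_top_dense[THEN iffD1, OF L_top, rule_format, of "max 1 (2 * B)"]
      root eventually_gt_at_top[of 0]
  proof eventually_elim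
    case (elim n)
    then have L: "L n > 1" "L n > 2 * B" and al: "1 < \<alpha> n" "\<alpha> n < L n"
      by (auto simp: divide_less_eq)
    have r: "is_centring_root (\<alpha> n) (L n) (\<xi> n / L n)"
      using elim by (simp add: L_def)
    then have "A n > 1"
      using centring_arg_0_gt_1[OF al] centring_arg_shift[of "\<alpha> n" "L n" "\<xi> n / L n"]
      by (auto simp: A_def is_centring_root_def)
    moreover have "\<xi> n = (\<alpha> n - 1) * ln (A n)"
      using r L by (auto simp: is_centring_root_def A_def field_simps)
    moreover have "\<bar>e n\<bar> \<le> B"
      using C[of "\<alpha> n"] al by (auto simp: e_def B_def)
    moreover have "u n = L n * A n + e n"
      using L al
      by (simp add: u_def A_def e_def L_def[symmetric] centring_arg_def stirling_remainder_def
          ln_div field_simps)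
    ultimately show ?case
      using L al elim by auto
  qed
  have half: "\<forall>\<^sub>F n in sequentially. u n > L n / 2 \<and> L n > 0"
    using ev
  proof eventually_elim
    case (elim n)
    then have "L n > 0" by linarith
    moreover have "L n * A n \<ge> L n * 1"
      using elim by (intro mult_left_mono) auto
    ultimately show ?case
      using elim by linarith
  qed
  then show "\<forall>\<^sub>F n in sequentially. u n > 0"
    by eventually_elim auto
  show "(\<lambda>n. (\<alpha> n - 1) / u n) \<longlonglongrightarrow> 0"
  proof (rule Lim_null_comparison)
    show "(\<lambda>n. 2 * (\<alpha> n / L n)) \<longlonglongrightarrow> 0"
      using tendsto_mult_left[OF ratio, of 2] by simp
    show "\<forall>\<^sub>F n in sequentially. norm ((\<alpha> n - 1) / u n) \<le> 2 * (\<alpha> n / L n)"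
      using ev half
    proof eventually_elim
      case (elim n)
      then have "(\<alpha> n - 1) / u n \<le> \<alpha> n / (L n / 2)"
        by (intro frac_le) auto
      then show ?case using elim by (auto simp: mult.commute)
    qed
  qed
  \<comment> \<open>Equal to \<open>(\<alpha> n - 1) * ln (u n / (L n * A n))\<close>, the part of
    the exponent of \<open>n\<close> times the density that is left beside
    \<open>- x\<close>.\<close>
  define d where "d n = (\<alpha> n - 1) * ln (1 + e n / (L n * A n))" for n
  have d: "d \<longlonglongrightarrow> 0"
  proof (rule Lim_null_comparison)
    show "(\<lambda>n. 2 * B * (\<alpha> n / L n)) \<longlonglongrightarrow> 0"
      using tendsto_mult_left[OF ratio, of "2 * B"] by simp
    show "\<forall>\<^sub>F n in sequentially. norm (d n) \<le> 2 * B * (\<alpha> n / L n)"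
      using ev half
    proof eventually_elim
      case (elim n)
      have LA: "L n * 1 \<le> L n * A n"
        using elim by (intro mult_left_mono) auto
      have y: "\<bar>e n / (L n * A n)\<bar> \<le> B / L n"
        using elim LA by (auto simp: abs_mult intro!: frac_le)
      also have "B / L n \<le> 1 / 2"
        using elim by (simp add: field_simps)
      finally have "\<bar>ln (1 + e n / (L n * A n))\<bar> \<le> 2 * \<bar>e n / (L n * A n)\<bar>"
        by (rule abs_ln_one_plus_le)
      with y have "\<bar>ln (1 + e n / (L n * A n))\<bar> \<le> 2 * (B / L n)"
        by linarith
      \<comment> \<open>The relative error is of order \<open>1 / L n\<close> and is multiplied by
        less than \<open>\<alpha> n\<close>; here \<open>\<alpha> n = o(L n)\<close> enters.\<close>
      then have "\<bar>d n\<bar> \<le> \<alpha> n * (2 * (B / L n))"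
        unfolding d_def abs_mult using elim by (intro mult_mono) auto
      then show ?case by (simp add: mult_ac)
    qed
  qed
  have "(\<lambda>n. exp (d n - x)) \<longlonglongrightarrow> exp (0 - x)"
    by (intro tendsto_intros d)
  moreover have "\<forall>\<^sub>F n in sequentially. exp (d n - x) = real n * gamma_density (\<alpha> n) (u n)"
    using ev half
  proof eventually_elim
    case (elim n)
    have LA: "L n * A n > 0" and u_pos: "u n > 0" and G: "Gamma (\<alpha> n) > 0"
      using elim by auto
    have "1 + e n / (L n * A n) = u n / (L n * A n)"
      using elim LA by (simp add: field_simps)
    then have "d n = (\<alpha> n - 1) * (ln (u n) - ln (L n) - ln (A n))"
      using elim u_pos LA by (simp add: d_def ln_div ln_mult)
    then have "d n = (\<alpha> n - 1) * ln (u n) - (\<alpha> n - 1) * ln (L n) - \<xi> n"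
      using elim by (simp add: right_diff_distrib)
    \<comment> \<open>Only the term \<open>- u n\<close> is expanded by its definition;
      \<open>ln (u n)\<close> stays, since it belongs to the power in the density.\<close>
    then have "d n - x = L n + (\<alpha> n - 1) * ln (u n) - u n - ln (Gamma (\<alpha> n))"
      unfolding u_def L_def by linarith
    then have "exp (d n - x)
        = exp (L n) * exp ((\<alpha> n - 1) * ln (u n)) * exp (- u n) / exp (ln (Gamma (\<alpha> n)))"
      by (simp add: exp_add[symmetric] exp_diff[symmetric])
    then show ?case
      using elim u_pos G by (simp add: gamma_density_def powr_def L_def)
  qed
  ultimately show "(\<lambda>n. real n * gamma_density (\<alpha> n) (u n)) \<longlonglongrightarrow> exp (- x)"
    by (simp add: tendsto_cong)
qed

section \<open>Convergence to the Gumbel law\<close>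

theorem theorem2p3:
  fixes P :: "nat \<Rightarrow> 'a measure"
    and Y :: "nat \<Rightarrow> nat \<Rightarrow> 'a \<Rightarrow> real"
    and \<alpha> :: "nat \<Rightarrow> real"
    and M :: "nat \<Rightarrow> 'a \<Rightarrow> real"
  assumes prob: "\<And>n. n \<ge> 1 \<Longrightarrow> prob_space (P n)"
    and alpha_pos: "\<And>n. n \<ge> 1 \<Longrightarrow> \<alpha> n > 0"
    and indep: "\<And>n. n \<ge> 1 \<Longrightarrow> prob_space.indep_vars (P n) (\<lambda>_. borel) (Y n) {1..n}"
    and gamma: "\<And>n i. n \<ge> 1 \<Longrightarrow> i \<in> {1..n} \<Longrightarrow>
      distributed (P n) lborel (Y n i) (\<lambda>u. ennreal (gamma_density (\<alpha> n) u))"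
    and M_def: "\<And>n \<omega>. n \<ge> 1 \<Longrightarrow> M n \<omega> = Max ((\<lambda>i. Y n i \<omega>) ` {1..n})"
    and alpha_top: "filterlim \<alpha> at_top sequentially"
    and alpha_o: "\<alpha> \<in> o[sequentially](\<lambda>n. ln (real n))"
  shows "(\<forall>\<^sub>F n in sequentially. \<exists>!z. is_centring_root (\<alpha> n) (ln (real n)) z) \<and>
    (\<forall>\<xi> :: nat \<Rightarrow> real.
      (\<forall>\<^sub>F n in sequentially. is_centring_root (\<alpha> n) (ln (real n)) (\<xi> n / ln (real n))) \<longrightarrow>
      weak_conv_m
        (\<lambda>n. distr (P n) borel
          (\<lambda>\<omega>. M n \<omega> - ln (real n) - (\<alpha> n - 1) * ln (ln (real n)) - \<xi> n + ln (Gamma (\<alpha> n))))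
        gumbel_distribution)"
proof -
  have alpha_gt_1: "\<forall>\<^sub>F n in sequentially. \<alpha> n > 1"
    using alpha_top by (simp add: filterlim_at_top_dense)
  show ?thesis
  proof (intro conjI allI impI)
    \<comment> \<open>The bound 1/2 is the condition \<open>2 * a < L\<close> of
      \<open>ex1_centring_root\<close>.\<close>
    have "\<forall>\<^sub>F n in sequentially. \<alpha> n / ln (real n) < 1 / 2"
      using order_tendstoD(2)[OF smalloD_tendsto[OF alpha_o], of "1/2"] by simp
    then show "\<forall>\<^sub>F n in sequentially. \<exists>!z. is_centring_root (\<alpha> n) (ln (real n)) z"
      using alpha_gt_1 eventually_gt_at_top[of 1]
      by eventually_elim (auto intro!: ex1_centring_root simp: divide_less_eq)
  next
    fix \<xi> :: "nat \<Rightarrow> real"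
    assume root: "\<forall>\<^sub>F n in sequentially. is_centring_root (\<alpha> n) (ln (real n)) (\<xi> n / ln (real n))"
    define W where "W n \<omega> = M n \<omega> - ln (real n) - (\<alpha> n - 1) * ln (ln (real n)) - \<xi> n
      + ln (Gamma (\<alpha> n))" for n \<omega>
    \<comment> \<open>Convergence is shown at every real \<open>x\<close>, hence at all continuity
      points of the limit.\<close>
    have "(\<lambda>n. cdf (distr (P n) borel (W n)) x) \<longlonglongrightarrow> gumbel_cdf x" for x
    proof -
      \<comment> \<open>Chosen so that \<open>W n \<omega> \<le> x\<close> is equivalent to
        \<open>M n \<omega> \<le> u n\<close>.\<close>
      define u where "u n = x + ln (real n) + (\<alpha> n - 1) * ln (ln (real n)) + \<xi> n
        - ln (Gamma (\<alpha> n))" for n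
      \<comment> \<open>Index 1 represents all the variables of row \<open>n\<close>;
        \<open>same\<close> below transfers the value through their common density.\<close>
      define p where "p n = measure (P n) {\<omega> \<in> space (P n). u n < Y n 1 \<omega>}" for n
      note centring = gamma_density_at_centring[OF alpha_top alpha_o root, of x, folded u_def]
      have ratio: "\<forall>\<^sub>F n in sequentially. (\<alpha> n - 1) / u n < 1"
        using order_tendstoD(2)[OF centring(2) zero_less_one] .
      have "(\<lambda>n. real n * p n) \<longlonglongrightarrow> exp (- x)"
      \<comment> \<open>The tail bounds enclose \<open>n * p n\<close> between \<open>n\<close>
        times the density and the same divided by \<open>1 - (\<alpha> n - 1) / u n\<close>, a
        factor tending to 1 and eventually positive.\<close>
      proof (rule tendsto_sandwich)
        show "(\<lambda>n. real n * gamma_density (\<alpha> n) (u n)) \<longlonglongrightarrow> exp (- x)"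
          by (rule centring(3))
        have "(\<lambda>n. real n * gamma_density (\<alpha> n) (u n) / (1 - (\<alpha> n - 1) / u n)) \<longlonglongrightarrow> exp (- x) / (1 - 0)"
          by (intro tendsto_intros centring) simp
        then show "(\<lambda>n. real n * gamma_density (\<alpha> n) (u n) / (1 - (\<alpha> n - 1) / u n)) \<longlonglongrightarrow> exp (- x)"
          by simp
        have bounds: "\<forall>\<^sub>F n in sequentially. gamma_density (\<alpha> n) (u n) \<le> p n \<and>
            (1 - (\<alpha> n - 1) / u n) * p n \<le> gamma_density (\<alpha> n) (u n)"
          using ratio centring(1) alpha_gt_1 eventually_ge_at_top[of 1]
        proof eventually_elim
          case (elim n)
          then have "\<alpha> n - 1 \<le> u n" by (simp add: divide_less_eq)
          then show ?case
            using gamma_tail_bounds[OF prob gamma, of n 1 "u n"] elim by (auto simp: p_def)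
        qed
        then show "\<forall>\<^sub>F n in sequentially. real n * gamma_density (\<alpha> n) (u n) \<le> real n * p n"
          by eventually_elim (auto intro!: mult_left_mono)
        show "\<forall>\<^sub>F n in sequentially.
            real n * p n \<le> real n * gamma_density (\<alpha> n) (u n) / (1 - (\<alpha> n - 1) / u n)"
          using bounds ratio
        proof eventually_elim
          case (elim n)
          have "p n \<le> gamma_density (\<alpha> n) (u n) / (1 - (\<alpha> n - 1) / u n)"
            using elim by (simp add: pos_le_divide_eq mult.commute)
          then have "real n * p n \<le> real n * (gamma_density (\<alpha> n) (u n) / (1 - (\<alpha> n - 1) / u n))"
            by (intro mult_left_mono) auto
          then show ?case by simp
        qed
      qed
      then have "(\<lambda>n. (1 - p n) ^ n) \<longlonglongrightarrow> gumbel_cdf x"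
        unfolding gumbel_cdf_def by (rule tendsto_one_minus_power)
      moreover have "\<forall>\<^sub>F n in sequentially. (1 - p n) ^ n = cdf (distr (P n) borel (W n)) x"
        using eventually_ge_at_top[of 1]
      proof eventually_elim
        case (elim n)
        interpret prob_space "P n" using prob elim by simp
        have [measurable]: "Y n i \<in> borel_measurable (P n)" if "i \<in> {1..n}" for i
          using distributed_measurable[OF gamma[OF elim that]] by simp
        have "M n = (\<lambda>\<omega>. Max ((\<lambda>i. Y n i \<omega>) ` {1..n}))"
          using M_def[OF elim] by auto
        then have [measurable]: "M n \<in> borel_measurable (P n)"
          by (auto intro!: borel_measurable_Max)
        have same: "measure (P n) {\<omega> \<in> space (P n). u n < Y n i \<omega>} = p n" if i: "i \<in> {1..n}" for i
        proof -
          have "measure (P n) (Y n j -` {u n<..} \<inter> space (P n))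
              = measure (density lborel (gamma_density (\<alpha> n))) {u n<..}" if "j \<in> {1..n}" for j
            using distributed_distr_eq_density[OF gamma[OF elim that]]
              measure_distr[OF distributed_measurable[OF gamma[OF elim that]], of "{u n<..}"]
            by simp
          from this[OF i] this[of 1] show ?thesis
            using elim by (simp add: p_def vimage_def Int_def conj_commute)
        qed
        have "cdf (distr (P n) borel (W n)) x = prob (W n -` {..x} \<inter> space (P n))"
          unfolding cdf_def by (intro measure_distr) (auto simp: W_def[abs_def])
        also have "W n -` {..x} \<inter> space (P n)
            = {\<omega> \<in> space (P n). Max ((\<lambda>i. Y n i \<omega>) ` {1..n}) \<le> u n}"
          by (auto simp: W_def u_def M_def[OF elim])
        also have "prob \<dots> = (1 - p n) ^ n"
          by (rule prob_Max_le[OF indep[OF elim] elim same])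
        finally show ?case by simp
      qed
      ultimately show ?thesis
        by (rule Lim_transform_eventually)
    qed
    then show "weak_conv_m (\<lambda>n. distr (P n) borel (\<lambda>\<omega>. M n \<omega> - ln (real n)
        - (\<alpha> n - 1) * ln (ln (real n)) - \<xi> n + ln (Gamma (\<alpha> n)))) gumbel_distribution"
      by (simp add: weak_conv_m_def weak_conv_def cdf_gumbel_distribution W_def[abs_def])
  qed
qed

end
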